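(* For every set $I$ of non-negative integers, \[\sup_{a\in\mathcal{A}}\underline{d_a}(I)=\sup_{a\in\mathcal{A}}\overline{d_a}(I)=\overline{d}(I).\]
   Context: For a sequence $a=(a_n)_{n\ge 0}$ of positive real numbers with $\sum_{n=0}^\infty a_n=\infty$ and a set $I$ of non-negative integers, define \[\overline{d_a}(I)=\limsup_{N\to\infty}\frac{\sum_{n\in[0,N]\cap I}a_n}{\sum_{n=0}^N a_n},\qquad \underline{d_a}(I)=\liminf_{N\to\infty}\frac{\sum_{n\in[0,N]\cap I}a_n}{\sum_{n=0}^N a_n}.\] The unweighted upper and lower densities $\overline{d}$, $\underline{d}$ correspond to $a_n=1$ for all $n$. $\mathcal{A}$ denotes the set of all sequences $a=(a_n)_{n\ge0}$ of positive real numbers which are decreasing (in the wide sense, i.e. $a_{n+1}\le a_n$ for all $n$), tend to $0$, and satisfy $\sum_{n=0}^\infty a_n=\infty$. *)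

theory Defs
  imports "HOL-Library.Extended_Real"
begin

text \<open>
  The densities are valued in \<^typ>\<open>ereal\<close>, a complete lattice, so that every limit superior,
  limit inferior and supremum exists without a boundedness side condition.
\<close>

definition weighted_ratio :: "(nat \<Rightarrow> real) \<Rightarrow> nat set \<Rightarrow> nat \<Rightarrow> real" where
  "weighted_ratio a I N = (\<Sum>n\<in>{0..N} \<inter> I. a n) / (\<Sum>n=0..N. a n)"

definition weighted_upper_density :: "(nat \<Rightarrow> real) \<Rightarrow> nat set \<Rightarrow> ereal" where
  "weighted_upper_density a I = limsup (\<lambda>N. ereal (weighted_ratio a I N))"

definition weighted_lower_density :: "(nat \<Rightarrow> real) \<Rightarrow> nat set \<Rightarrow> ereal" where
  "weighted_lower_density a I = liminf (\<lambda>N. ereal (weighted_ratio a I N))"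

definition upper_density :: "nat set \<Rightarrow> ereal" where
  "upper_density I = weighted_upper_density (\<lambda>_. 1) I"

definition decreasing_weights :: "(nat \<Rightarrow> real) set" where
  "decreasing_weights = {a. (\<forall>n. 0 < a n) \<and> decseq a \<and> a \<longlonglongrightarrow> 0 \<and>
     filterlim (\<lambda>N. \<Sum>n=0..N. a n) at_top sequentially}"

end

theory Submission
  imports Defs
begin

text \<open>
  For a real \<open>c\<close> put \<open>x n = of_bool (n \<in> I) - c\<close>. Then the weighted ratio exceeds \<open>c\<close> by
  \<open>(\<Sum>n\<le>N. a n * x n) / (\<Sum>n\<le>N. a n)\<close>, and since the denominator tends to infinity, a bounded
  numerator cannot influence the limit (\<open>weighted_ratio_eq\<close>). Everything therefore reduces to
  bounding the weighted sums of \<open>x\<close> from one side.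

  If \<open>c\<close> exceeds the upper density, the partial sums of \<open>x\<close> are eventually negative, hence bounded
  above, and Abel summation carries this bound over to every decreasing weight. So
  no weighted upper density is larger than the unweighted one
  (\<open>weighted_upper_density_le_upper_density\<close>).

  If \<open>c\<close> is less than the upper density, there are arbitrarily long initial segments
  \<open>{..<m k}\<close> on which the sum of \<open>x\<close> is nonnegative. The weight \<open>a\<close> is taken to be the sum of the
  uniform probability distributions on these segments, with \<open>m k\<close> at least doubling at each step.
  Cut off at \<open>N\<close>, the segments contained in \<open>{..N}\<close> contribute nonnegatively to the weighted sum
  of \<open>x\<close>; the others contribute little, because their distributions give \<open>{..N}\<close> masses which
  decay geometrically and add up to at most 2. So the weighted sums are bounded below and the
  weighted lower density is at least \<open>c\<close> (\<open>weighted_lower_density_segment_weight\<close>).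
\<close>

section \<open>Comparing a density with a constant\<close>

lemma weighted_ratio_eq:
  assumes "(\<Sum>n=0..N. a n) > 0"
  shows "weighted_ratio a I N =
           c + (\<Sum>n=0..N. a n * (of_bool (n \<in> I) - c)) / (\<Sum>n=0..N. a n)"
proof -
  have "(\<Sum>n\<in>{0..N} \<inter> I. a n) = (\<Sum>n=0..N. a n * of_bool (n \<in> I))"
    by (simp add: sum.inter_restrict of_bool_def if_distrib cong: if_cong)
  then show ?thesis
    using assms
    by (simp add: weighted_ratio_def algebra_simps sum_subtractf sum_distrib_left field_simps)
qed

lemma decreasing_weightsD:
  assumes "a \<in> decreasing_weights"
  shows "0 < a n" "decseq a" "filterlim (\<lambda>N. \<Sum>n=0..N. a n) at_top sequentially"
    and sum_decreasing_weights_pos: "(\<Sum>n=0..N. a n) > 0"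
  using assms by (auto simp: decreasing_weights_def intro!: sum_pos)

lemma tendsto_add_const_over_weights:
  assumes "a \<in> decreasing_weights"
  shows "(\<lambda>N. ereal (c + b / (\<Sum>n=0..N. a n))) \<longlonglongrightarrow> ereal c"
proof -
  have "(\<lambda>N. b / (\<Sum>n=0..N. a n)) \<longlonglongrightarrow> 0"
    using decreasing_weightsD(3)[OF assms]
    by (intro tendsto_divide_0[OF tendsto_const] filterlim_at_top_imp_at_infinity)
  from tendsto_add[OF tendsto_const this, of c] show ?thesis
    by (simp add: tendsto_ereal)
qed

lemma weighted_upper_density_le:
  assumes a: "a \<in> decreasing_weights"
    and bound: "\<And>N. (\<Sum>n=0..N. a n * (of_bool (n \<in> I) - c)) \<le> b"
  shows "weighted_upper_density a I \<le> ereal c"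
proof -
  have "weighted_ratio a I N \<le> c + b / (\<Sum>n=0..N. a n)" for N
    using weighted_ratio_eq[where c=c, OF sum_decreasing_weights_pos[OF a]]
      bound[of N] sum_decreasing_weights_pos[OF a, of N] by (simp add: divide_right_mono)
  then have "weighted_upper_density a I \<le> limsup (\<lambda>N. ereal (c + b / (\<Sum>n=0..N. a n)))"
    unfolding weighted_upper_density_def by (intro Limsup_mono) auto
  also have "\<dots> = ereal c"
    by (intro lim_imp_Limsup tendsto_add_const_over_weights[OF a]) auto
  finally show ?thesis .
qed

lemma weighted_lower_density_ge:
  assumes a: "a \<in> decreasing_weights"
    and bound: "\<And>N. (\<Sum>n=0..N. a n * (of_bool (n \<in> I) - c)) \<ge> b"
  shows "weighted_lower_density a I \<ge> ereal c"
proof -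
  have "weighted_ratio a I N \<ge> c + b / (\<Sum>n=0..N. a n)" for N
    using weighted_ratio_eq[where c=c, OF sum_decreasing_weights_pos[OF a]]
      bound[of N] sum_decreasing_weights_pos[OF a, of N] by (simp add: divide_right_mono)
  then have "weighted_lower_density a I \<ge> liminf (\<lambda>N. ereal (c + b / (\<Sum>n=0..N. a n)))"
    unfolding weighted_lower_density_def by (intro Liminf_mono) auto
  moreover have "liminf (\<lambda>N. ereal (c + b / (\<Sum>n=0..N. a n))) = ereal c"
    by (intro lim_imp_Liminf tendsto_add_const_over_weights[OF a]) auto
  ultimately show ?thesis by simp
qed

section \<open>Decreasing weights do not increase the upper density\<close>

text \<open>
  Abel's inequality. The induction needs the sharper bound \<open>a 0 * M - a N * (M - X N)\<close>, where
  \<open>X N\<close> is the partial sum of \<open>x\<close>: as \<open>M - X N \<ge> 0\<close>, replacing \<open>a N\<close> by the smaller weight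
  \<open>a (Suc N)\<close> only raises it.
\<close>

lemma Abel_sum_le:
  fixes a x :: "nat \<Rightarrow> real"
  assumes "decseq a" "\<And>n. 0 \<le> a n" and X: "\<And>N. (\<Sum>n=0..N. x n) \<le> M"
  shows "(\<Sum>n=0..N. a n * x n) \<le> a 0 * M"
proof -
  have "(\<Sum>n=0..N. a n * x n) \<le> a 0 * M - a N * (M - (\<Sum>n=0..N. x n))"
  proof (induction N)
    case (Suc N)
    have "a (Suc N) * (M - (\<Sum>n=0..N. x n)) \<le> a N * (M - (\<Sum>n=0..N. x n))"
      using X[of N] decseq_SucD[OF assms(1)] by (intro mult_right_mono) auto
    with Suc show ?case by (simp add: algebra_simps)
  qed (simp add: algebra_simps)
  moreover have "0 \<le> a N * (M - (\<Sum>n=0..N. x n))"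
    using X[of N] assms(2) by simp
  ultimately show ?thesis by linarith
qed

lemma bounded_above_of_eventually_nonpos:
  fixes x :: "nat \<Rightarrow> real"
  assumes "\<forall>\<^sub>F N in sequentially. (\<Sum>n=0..N. x n) \<le> 0"
  obtains M where "\<And>N. (\<Sum>n=0..N. x n) \<le> M"
proof -
  obtain K where K: "\<And>N. N \<ge> K \<Longrightarrow> (\<Sum>n=0..N. x n) \<le> 0"
    using assms by (auto simp: eventually_sequentially)
  have "(\<Sum>n=0..N. x n) \<le> (\<Sum>n=0..K. \<bar>x n\<bar>)" for N
  proof (cases "N \<ge> K")
    case True
    have "0 \<le> (\<Sum>n=0..K. \<bar>x n\<bar>)" by (intro sum_nonneg) auto
    with K[OF True] show ?thesis by linarith
  next
    case False
    have "(\<Sum>n=0..N. x n) \<le> (\<Sum>n=0..N. \<bar>x n\<bar>)" by (intro sum_mono) auto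
    also have "\<dots> \<le> (\<Sum>n=0..K. \<bar>x n\<bar>)" using False by (intro sum_mono2) auto
    finally show ?thesis .
  qed
  then show ?thesis by (rule that)
qed

lemma unweighted_ratio_eq:
  "weighted_ratio (\<lambda>_. 1) I N = c + (\<Sum>n=0..N. of_bool (n \<in> I) - c) / (real N + 1)"
  using weighted_ratio_eq[of "\<lambda>_. 1" N I c] by (simp add: add.commute)

lemma weighted_upper_density_le_upper_density:
  assumes a: "a \<in> decreasing_weights"
  shows "weighted_upper_density a I \<le> upper_density I"
proof (rule ccontr)
  assume "\<not> weighted_upper_density a I \<le> upper_density I"
  then obtain c where c: "upper_density I < ereal c" "ereal c < weighted_upper_density a I"
    using ereal_dense2[of "upper_density I"] by (auto simp: not_le)
  have "\<forall>\<^sub>F N in sequentially. ereal (weighted_ratio (\<lambda>_. 1) I N) < ereal c"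
    using c(1) unfolding upper_density_def weighted_upper_density_def by (rule Limsup_lessD)
  then have "\<forall>\<^sub>F N in sequentially. (\<Sum>n=0..N. of_bool (n \<in> I) - c) \<le> 0"
    by eventually_elim (simp add: unweighted_ratio_eq[of I _ c] divide_less_0_iff)
  then obtain M where "\<And>N. (\<Sum>n=0..N. of_bool (n \<in> I) - c) \<le> M"
    using bounded_above_of_eventually_nonpos by blast
  then have "(\<Sum>n=0..N. a n * (of_bool (n \<in> I) - c)) \<le> a 0 * M" for N
    using decreasing_weightsD[OF a] by (intro Abel_sum_le) (auto intro: less_imp_le)
  from weighted_upper_density_le[OF a this] c(2) show False by simp
qed

section \<open>Sums of uniform distributions on initial segments\<close>

text \<open>
  The point masses of the infinite measure \<open>\<Sum>k. uniform {..<m k}\<close> on the natural numbers. The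
  total mass has to be infinite for the weight to be divergent.
\<close>

definition segment_weight :: "(nat \<Rightarrow> nat) \<Rightarrow> nat \<Rightarrow> real" where
  "segment_weight m n = (\<Sum>k. if n < m k then 1 / real (m k) else 0)"

definition doubling :: "(nat \<Rightarrow> nat) \<Rightarrow> bool" where
  "doubling m \<longleftrightarrow> 0 < m 0 \<and> (\<forall>k. 2 * m k \<le> m (Suc k))"

lemma doubling_power_le: "doubling m \<Longrightarrow> m i * 2 ^ j \<le> m (i + j)"
  by (induction j) (auto simp: doubling_def intro: order_trans[rotated])

lemma doubling_pos: "doubling m \<Longrightarrow> 0 < m k"
  using doubling_power_le[of m 0 k] by (auto simp: doubling_def intro: Nat.gr0I)

lemma doubling_mono: "doubling m \<Longrightarrow> i \<le> j \<Longrightarrow> m i \<le> m j"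
  by (rule lift_Suc_mono_le[of m]) (use doubling_def in \<open>auto intro: order_trans[rotated]\<close>)

lemma doubling_unbounded:
  assumes "doubling m"
  obtains k where "L < m k"
proof (rule that[of L])
  have "L < 2 ^ L" by simp
  also have "\<dots> \<le> m 0 * 2 ^ L" using assms by (simp add: doubling_def)
  also have "\<dots> \<le> m L" using doubling_power_le[OF assms, of 0 L] by simp
  finally show "L < m L" .
qed

lemma summable_segment_weight:
  assumes "doubling m"
  shows "summable (\<lambda>k. if n < m k then 1 / real (m k) else 0)"
proof (rule summable_comparison_test')
  show "summable (\<lambda>k. (1/2::real) ^ k)" by (simp add: summable_geometric)
  fix k
  have "2 ^ k \<le> m 0 * 2 ^ k" using assms by (simp add: doubling_def)
  also have "\<dots> \<le> m k" using doubling_power_le[OF assms, of 0 k] by simp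
  finally have "2 ^ k \<le> real (m k)" by (metis of_nat_le_iff of_nat_numeral of_nat_power)
  then show "norm (if n < m k then 1 / real (m k) else 0) \<le> (1/2) ^ k"
    by (simp add: power_one_over frac_le)
qed

text \<open>
  Integrating \<open>x\<close> over \<open>{..<L}\<close> against the measure, one uniform distribution at a time.
\<close>

lemma segment_weight_sums:
  assumes "doubling m"
  shows "(\<lambda>k. (\<Sum>n<min L (m k). x n) / real (m k)) sums (\<Sum>n<L. segment_weight m n * x n)"
proof -
  have "(\<lambda>k. \<Sum>n<L. (if n < m k then 1 / real (m k) else 0) * x n)
          sums (\<Sum>n<L. segment_weight m n * x n)"
    unfolding segment_weight_def
    by (intro sums_sum sums_mult2 summable_sums summable_segment_weight assms)
  moreover have "(\<Sum>n<L. (if n < m k then 1 / real (m k) else 0) * x n)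
                   = (\<Sum>n<min L (m k). x n) / real (m k)" for k
  proof -
    have "{..<min L (m k)} = {..<L} \<inter> {..<m k}" by auto
    then show ?thesis
      by (simp add: sum.inter_restrict sum_divide_distrib if_distrib cong: if_cong)
         (intro sum.cong, auto)
  qed
  ultimately show ?thesis by simp
qed

text \<open>
  The left-hand side is the mass which the distributions on segments longer than \<open>L\<close> give to
  \<open>{..<L}\<close>. If the first such segment is \<open>{..<m i}\<close>, the \<open>j\<close>-th one after it contributes
  \<open>L / m (i + j) \<le> (1/2) ^ j\<close>. Read as a bound on the weight itself, this says that it is
  at most \<open>2 / L\<close>, so that it tends to 0.
\<close>

lemma mass_from_long_segments_le:
  assumes "doubling m"
  shows "real L * segment_weight m L \<le> 2"
proof -
  let ?f = "\<lambda>k. if L < m k then 1 / real (m k) else 0"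
  define i where "i = (LEAST i. L < m i)"
  have i: "L < m i" "\<And>k. k < i \<Longrightarrow> \<not> L < m k"
    using doubling_unbounded[OF assms] LeastI not_less_Least unfolding i_def by metis+
  let ?g = "\<lambda>k. if k < i then 0 else (1/2::real) ^ (k - i)"
  have "?g sums 2"
    using sums_zero_iff_shift[of i ?g 2] geometric_sums[of "1/2::real"] by simp
  moreover have "(\<lambda>k. real L * ?f k) sums (real L * segment_weight m L)"
    unfolding segment_weight_def
    by (intro sums_mult summable_sums summable_segment_weight assms)
  moreover have "real L * ?f k \<le> ?g k" for k
  proof (cases "k < i")
    case False
    then obtain j where k: "k = i + j" by (metis le_Suc_ex not_less)
    have "L * 2 ^ j \<le> m i * 2 ^ j" using i(1) by simp
    also have "\<dots> \<le> m k" using doubling_power_le[OF assms] k by simp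
    finally have "real L * 2 ^ j \<le> real (m k)"
      by (metis of_nat_le_iff of_nat_mult of_nat_numeral of_nat_power)
    then show ?thesis
      using k doubling_pos[OF assms, of k] by (simp add: field_simps)
  qed (use i in simp)
  ultimately show ?thesis by (meson sums_le)
qed

lemma segment_weight_in_decreasing_weights:
  assumes "doubling m"
  shows "segment_weight m \<in> decreasing_weights"
proof -
  have "0 < segment_weight m n" for n
  proof -
    obtain k where "n < m k" using doubling_unbounded[OF assms] .
    then show ?thesis
      unfolding segment_weight_def
      by (intro suminf_pos2[OF summable_segment_weight[OF assms], of _ k]) auto
  qed
  moreover have "decseq (segment_weight m)"
    unfolding segment_weight_def decseq_def
    by (intro allI impI suminf_le summable_segment_weight assms) auto
  moreover have "segment_weight m \<longlonglongrightarrow> 0"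
  proof (rule tendsto_sandwich[of "\<lambda>_. 0" _ _ "\<lambda>n. 2 / real n"])
    show "(\<lambda>n. 2 / real n) \<longlonglongrightarrow> 0" by (rule lim_const_over_n)
    show "\<forall>\<^sub>F n in sequentially. segment_weight m n \<le> 2 / real n"
      using eventually_gt_at_top[of 0]
    proof eventually_elim
      case (elim n)
      then show ?case using mass_from_long_segments_le[OF assms, of n] by (simp add: field_simps)
    qed
    show "\<forall>\<^sub>F n in sequentially. 0 \<le> segment_weight m n"
      using \<open>\<And>n. 0 < segment_weight m n\<close> by (simp add: less_imp_le)
  qed simp
  moreover have "filterlim (\<lambda>N. \<Sum>n=0..N. segment_weight m n) at_top sequentially"
    unfolding filterlim_at_top
  proof
    fix Z :: real
    obtain K :: nat where K: "Z \<le> real K" using real_arch_simple by blast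
    have "Z \<le> (\<Sum>n=0..N. segment_weight m n)" if "m K \<le> N" for N
    proof -
      \<comment> \<open>Each of the first \<open>K\<close> distributions has its whole mass 1 in \<open>{..N}\<close>.\<close>
      have "(\<Sum>n<min (Suc N) (m k). 1) / real (m k) = 1" if "k < K" for k
        using doubling_mono[OF assms, of k K] doubling_pos[OF assms, of k] that \<open>m K \<le> N\<close>
        by (simp add: min_absorb2)
      then have "(\<Sum>k<K. (\<Sum>n<min (Suc N) (m k). 1) / real (m k)) = (\<Sum>k<K. 1)"
        by (intro sum.cong refl) (metis lessThan_iff)
      then have "real K = (\<Sum>k<K. (\<Sum>n<min (Suc N) (m k). 1) / real (m k))"
        by (metis card_lessThan real_of_card)
      also have "\<dots> \<le> (\<Sum>k. (\<Sum>n<min (Suc N) (m k). 1) / real (m k))"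
        by (intro sum_le_suminf sums_summable[OF segment_weight_sums[OF assms]]) auto
      also have "\<dots> = (\<Sum>n<Suc N. segment_weight m n * 1)"
        by (rule sums_unique[OF segment_weight_sums[OF assms], symmetric])
      finally show ?thesis
        using K by (simp add: atLeast0AtMost lessThan_Suc_atMost)
    qed
    then show "\<forall>\<^sub>F N in sequentially. Z \<le> (\<Sum>n=0..N. segment_weight m n)"
      by (auto simp: eventually_sequentially)
  qed
  ultimately show ?thesis by (simp add: decreasing_weights_def)
qed

section \<open>Weights whose lower density approaches the upper density\<close>

text \<open>
  The weighted sum of \<open>x\<close> over \<open>{..N}\<close> is at least \<open>- 2 * \<bar>c\<bar>\<close>: a distribution on a segment
  inside \<open>{..N}\<close> integrates \<open>x\<close> to a nonnegative number, and on the mass in \<open>{..N}\<close> that comes from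
  the longer segments \<open>x\<close> is at least \<open>- \<bar>c\<bar>\<close>.
\<close>

lemma weighted_lower_density_segment_weight:
  assumes m: "doubling m" and dense: "\<And>k. 0 \<le> (\<Sum>n<m k. of_bool (n \<in> I) - c)"
  shows "ereal c \<le> weighted_lower_density (segment_weight m) I"
proof (rule weighted_lower_density_ge[OF segment_weight_in_decreasing_weights[OF m]])
  fix N
  define L where "L = Suc N"
  define x where "x n = of_bool (n \<in> I) - c" for n
  let ?f = "\<lambda>k. if L < m k then 1 / real (m k) else 0"
  have "- \<bar>c\<bar> * real L * ?f k \<le> (\<Sum>n<min L (m k). x n) / real (m k)" for k
  proof (cases "L < m k")
    case True
    have "- \<bar>c\<bar> * real L \<le> (\<Sum>n<L. x n)"
      using sum_mono[of "{..<L}" "\<lambda>_. - \<bar>c\<bar>" x] by (simp add: x_def mult.commute of_bool_def abs_if)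
    from divide_right_mono[OF this, of "real (m k)"] show ?thesis
      using True by (simp add: min_absorb1)
  next
    case False
    then show ?thesis using dense[of k] by (simp add: x_def min_absorb2)
  qed
  moreover have "(\<lambda>k. - \<bar>c\<bar> * real L * ?f k) sums (- \<bar>c\<bar> * real L * segment_weight m L)"
    unfolding segment_weight_def
    by (intro sums_mult summable_sums summable_segment_weight m)
  ultimately have "- \<bar>c\<bar> * real L * segment_weight m L \<le> (\<Sum>n<L. segment_weight m n * x n)"
    using segment_weight_sums[OF m, where L=L and x=x] by (rule sums_le)
  moreover have "\<bar>c\<bar> * (real L * segment_weight m L) \<le> \<bar>c\<bar> * 2"
    by (intro mult_left_mono mass_from_long_segments_le m) auto
  ultimately show "- 2 * \<bar>c\<bar> \<le> (\<Sum>n=0..N. segment_weight m n * (of_bool (n \<in> I) - c))"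
    by (simp add: L_def x_def atLeast0AtMost lessThan_Suc_atMost)
qed

lemma doubling_dense_segments:
  assumes "ereal c < upper_density I"
  obtains m where "doubling m" "\<And>k. 0 \<le> (\<Sum>n<m k. of_bool (n \<in> I) - c)"
proof -
  let ?dense = "\<lambda>M. 0 < M \<and> 0 \<le> (\<Sum>n<M. of_bool (n \<in> I) - c)"
  have long: "\<exists>M\<ge>K. ?dense M" for K
  proof (rule ccontr)
    assume none: "\<not> (\<exists>M\<ge>K. ?dense M)"
    have "weighted_ratio (\<lambda>_. 1) I N \<le> c" if "N \<ge> K" for N
    proof -
      have "(\<Sum>n<Suc N. of_bool (n \<in> I) - c) < 0"
        using none that by (metis le_SucI not_less zero_less_Suc)
      then show ?thesis
        by (simp add: unweighted_ratio_eq[of I N c] atLeast0AtMost divide_le_0_iff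
              flip: lessThan_Suc_atMost)
    qed
    then have "upper_density I \<le> ereal c"
      unfolding upper_density_def weighted_upper_density_def
      by (intro Limsup_bounded) (auto simp: eventually_sequentially)
    with assms show False by simp
  qed
  obtain m where "\<And>k. ?dense (m k)" "\<And>k. 2 * m k \<le> m (Suc k)"
    using dependent_nat_choice[of "\<lambda>_ M. ?dense M" "\<lambda>_ M M'. 2 * M \<le> M'"] long by blast
  then show ?thesis using that[of m] by (auto simp: doubling_def)
qed

theorem corollary1p2:
  fixes I :: "nat set"
  shows "(SUP a\<in>decreasing_weights. weighted_lower_density a I) =
           (SUP a\<in>decreasing_weights. weighted_upper_density a I) \<and>
         (SUP a\<in>decreasing_weights. weighted_upper_density a I) = upper_density I"
proof -
  let ?low = "SUP a\<in>decreasing_weights. weighted_lower_density a I"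
  let ?upp = "SUP a\<in>decreasing_weights. weighted_upper_density a I"
  have "upper_density I \<le> ?low"
  proof (rule ccontr)
    assume "\<not> upper_density I \<le> ?low"
    then obtain c where c: "?low < ereal c" "ereal c < upper_density I"
      using ereal_dense2[of ?low] by (auto simp: not_le)
    obtain m where m: "doubling m" "\<And>k. 0 \<le> (\<Sum>n<m k. of_bool (n \<in> I) - c)"
      using doubling_dense_segments[OF c(2)] by metis
    have "ereal c \<le> ?low"
      by (intro SUP_upper2[of "segment_weight m"] segment_weight_in_decreasing_weights
            weighted_lower_density_segment_weight m)
    with c(1) show False by simp
  qed
  moreover have "?low \<le> ?upp"
    unfolding weighted_lower_density_def weighted_upper_density_def
    by (intro SUP_mono') (simp add: Liminf_le_Limsup)
  moreover have "?upp \<le> upper_density I"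
    by (intro SUP_least weighted_upper_density_le_upper_density)
  ultimately show ?thesis by auto
qed

end
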